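(* Let $q$ be a prime power and $n=u_1^{a_1}u_2^{a_2}\cdots u_t^{a_t}$, where $u_1,\dots,u_t$ are pairwise distinct primes and $a_1,\dots,a_t$ are nonnegative integers. For any $\vec{i}=(i_1,\dots,i_t)\in\prod_{1\le j\le t}\{0,1,\dots,a_j\}$, the number of nonzero subspaces of $\mathbb{F}_{q^n}$ that are maximally defined over the intermediate field $\mathbb{F}_{i_1,\dots,i_t}=\mathbb{F}_{q^{u_1^{i_1}\cdots u_t^{i_t}}}$ is $$N\left(u_1^{a_1-i_1}\cdots u_t^{a_t-i_t},\,q^{u_1^{i_1}\cdots u_t^{i_t}}\right)-\sum_{1\le j\le t}N_{\vec{i}}(j)+\sum_{1\le j_1<j_2\le t}N_{\vec{i}}(j_1,j_2)-\cdots-(-1)^{t-1}N_{\vec{i}}(1,2,\dots,t).$$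
   Context: For a prime power $Q$ and $m\ge 1$, $N(m,Q)$ denotes the number of nonzero $\mathbb{F}_Q$-subspaces of an $m$-dimensional $\mathbb{F}_Q$-vector space: $$N(m,Q)=\sum_{k=1}^{m}\frac{(Q^m-1)(Q^m-Q)\cdots(Q^m-Q^{k-1})}{(Q^k-1)(Q^k-Q)\cdots(Q^k-Q^{k-1})}.$$ A nonzero subspace $V\subseteq\mathbb{F}_{q^n}$ is maximally defined over an intermediate field $K$ of $\mathbb{F}_{q^n}/\mathbb{F}_q$ if $V$ is a $K$-subspace of $\mathbb{F}_{q^n}$ but is not a $K'$-subspace for any intermediate field $K'$ properly containing $K$. For $J=\{j_1<\cdots<j_v\}\subseteq\{1,\dots,t\}$ nonempty, define $$N_{\vec{i}}(j_1,\dots,j_v)=N\left(\prod_{j\in J}u_j^{a_j-i_j-1}\prod_{\mu\notin J}u_\mu^{a_\mu-i_\mu},\; q^{\prod_{j\in J}u_j^{i_j+1}\prod_{\mu\notin J}u_\mu^{i_\mu}}\right)$$ if $i_j+1\le a_j$ for all $j\in J$, and $N_{\vec{i}}(j_1,\dots,j_v)=0$ if $i_j+1>a_j$ for some $j\in J$. *)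

theory Defs
  imports "HOL-Algebra.Embedded_Algebras" "HOL-Number_Theory.Prime_Powers"
begin

(* The formula for N(m,Q). Taken in rat: there the subtractions and the divisions are
   the mathematical ones. *)
definition num_subspaces :: "nat \<Rightarrow> nat \<Rightarrow> rat" where
  "num_subspaces m Q =
     (\<Sum>k = 1..m. (\<Prod>l<k. of_nat Q ^ m - of_nat Q ^ l) / (\<Prod>l<k. of_nat Q ^ k - of_nat Q ^ l))"

definition intermediate_field :: "'a set \<Rightarrow> 'a set \<Rightarrow> ('a, 'b) ring_scheme \<Rightarrow> bool" where
  "intermediate_field F K L \<longleftrightarrow> subfield K L \<and> F \<subseteq> K"

(* For a subfield K of L, the library predicate "subalgebra K V L" says that V is an additive
   subgroup of L closed under multiplication by elements of K (not necessarily under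
   multiplication by elements of V), i.e. a K-subspace of L. *)
definition maximally_defined_over ::
    "('a, 'b) ring_scheme \<Rightarrow> 'a set \<Rightarrow> 'a set \<Rightarrow> 'a set \<Rightarrow> bool" where
  "maximally_defined_over L F K V \<longleftrightarrow>
     intermediate_field F K L \<and> subalgebra F V L \<and> V \<noteq> {\<zero>\<^bsub>L\<^esub>} \<and>
     subalgebra K V L \<and>
     (\<forall>K'. intermediate_field F K' L \<and> K \<subset> K' \<longrightarrow> \<not> subalgebra K' V L)"

(* N_i(J) for a set J of indices in {1..t}; u, a, i are the families of primes u_j,
   exponents a_j and exponents i_j. *)
definition num_subspaces_idx ::
    "nat \<Rightarrow> nat \<Rightarrow> (nat \<Rightarrow> nat) \<Rightarrow> (nat \<Rightarrow> nat) \<Rightarrow> (nat \<Rightarrow> nat) \<Rightarrow> nat set \<Rightarrow> rat" where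
  "num_subspaces_idx q t u a i J =
     (if \<forall>j\<in>J. i j + 1 \<le> a j
      then num_subspaces
             ((\<Prod>j\<in>J. u j ^ (a j - i j - 1)) * (\<Prod>\<mu>\<in>{1..t} - J. u \<mu> ^ (a \<mu> - i \<mu>)))
             (q ^ ((\<Prod>j\<in>J. u j ^ (i j + 1)) * (\<Prod>\<mu>\<in>{1..t} - J. u \<mu> ^ i \<mu>)))
      else 0)"

end

theory Submission
  imports Defs
begin

text \<open>
  The multipliers \<open>{x. x V \<subseteq> V}\<close> of a nonzero subspace \<open>V\<close> form a subfield, its stabilizer; \<open>V\<close> is a
  \<open>K'\<close>-subspace iff \<open>K'\<close> lies in the stabilizer, and \<open>V\<close> is maximally defined over \<open>K\<close> iff \<open>K\<close> is
  the stabilizer. As the intermediate fields of \<open>L\<close> correspond to the divisors of \<open>n\<close>, the stabilizer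
  is recorded by its degree \<open>d V\<close> over \<open>F\<close>, and the subspaces with \<open>e dvd d V\<close> are exactly those over the
  field with \<open>q ^ e\<close> elements, which are counted through ordered bases. Writing \<open>d V = P m\<close> with \<open>P\<close> the
  degree of \<open>K\<close>, the indicator of \<open>m = 1\<close> is the product over \<open>j\<close> of one minus the indicator of \<open>u j dvd m\<close>;
  expanding this product and summing over \<open>V\<close> gives the alternating sum.
\<close>

section \<open>Counting subspaces of a given dimension through independent lists\<close>

text \<open>The map sending \<open>(k, v)\<close> to \<open>k \<otimes> a \<oplus> v\<close> is
  injective on \<open>K \<times> E\<close>: a collision with distinct scalars could be solved for
  \<open>a\<close>, placing it in \<open>E\<close>.\<close>

lemma (in ring) card_line_extension:
  assumes K: "subfield K R" and E: "subalgebra K E R"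
    and a: "a \<in> carrier R" "a \<notin> E"
  shows "card (line_extension K a E) = card K * card E"
proof -
  note sub = subringE[OF subfieldE(1)[OF K]]
  have Es: "E \<subseteq> carrier R" using subalgebra_in_carrier[OF E] .
  have Eg: "subgroup E (add_monoid R)" using subalgebra.axioms(1)[OF E] .
  have eq: "line_extension K a E = (\<lambda>(k, v). k \<otimes> a \<oplus> v) ` (K \<times> E)"
    by (auto simp: line_extension_mem_iff) blast
  have "inj_on (\<lambda>(k, v). k \<otimes> a \<oplus> v) (K \<times> E)"
  proof (rule inj_onI, clarify)
    fix k v k' v'
    assume kv: "k \<in> K" "v \<in> E" "k' \<in> K" "v' \<in> E"
      and e: "k \<otimes> a \<oplus> v = k' \<otimes> a \<oplus> v'"
    have c: "k \<in> carrier R" "k' \<in> carrier R" "v \<in> carrier R" "v' \<in> carrier R"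
      using kv sub(1) Es by auto
    have "(k \<ominus> k') \<otimes> a = (k \<otimes> a \<oplus> v) \<ominus> k' \<otimes> a \<ominus> v" using c a(1) by algebra
    also have "\<dots> = v' \<ominus> v" unfolding e using c a(1) by algebra
    finally have d: "(k \<ominus> k') \<otimes> a = v' \<ominus> v" .
    have vE: "v' \<ominus> v \<in> E"
      using kv add.subgroupE(3,4)[OF Eg] by (simp add: a_minus_def)
    have dK: "k \<ominus> k' \<in> K" using kv sub(5,7) by (simp add: a_minus_def)
    have "k \<ominus> k' = \<zero>"
    proof (rule ccontr)
      assume "k \<ominus> k' \<noteq> \<zero>"
      then have i: "inv (k \<ominus> k') \<in> K" "inv (k \<ominus> k') \<otimes> (k \<ominus> k') = \<one>"
        using subfield_m_inv[OF K, of "k \<ominus> k'"] dK by auto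
      have "inv (k \<ominus> k') \<otimes> ((k \<ominus> k') \<otimes> a) \<in> E"
        using subalgebra.smult_closed[OF E i(1)] vE d by simp
      moreover have "inv (k \<ominus> k') \<otimes> ((k \<ominus> k') \<otimes> a) = a"
        using i c a(1) m_assoc[of "inv (k \<ominus> k')" "k \<ominus> k'" a] sub(1) by auto
      ultimately show False using a(2) by simp
    qed
    then have k: "k = k'" using c by simp
    then show "k = k' \<and> v = v'" using e c a(1) by simp
  qed
  then show ?thesis unfolding eq by (simp add: card_image card_cartesian_product)
qed

lemma (in ring) card_dimension:
  assumes K: "subfield K R" and "dimension n K E"
  shows "card E = card K ^ n"
  using assms(2)
proof (induction n arbitrary: E)
  case 0
  then have "E = {\<zero>}" using dimension_zero[OF K] by blast
  then show ?case by simp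
next
  case (Suc n)
  from Suc.prems obtain v E' where v: "v \<in> carrier R" "v \<notin> E'" "dimension n K E'"
    and E: "E = line_extension K v E'"
    by (cases rule: dimension.cases) auto
  show ?case
    unfolding E using card_line_extension[OF K _ v(1,2)] Suc.IH[OF v(3)]
      finite_dimension_imp_subalgebra[OF K finite_dimensionI[OF v(3)]] by simp
qed

text \<open>Once \<open>l\<close> independent vectors are chosen, the next one ranges over
  \<open>E\<close> minus their span, which has \<open>card K ^ l\<close> elements. For
  \<open>k > m\<close> the factor at \<open>l = m\<close> makes the product zero, as it should
  be.\<close>

lemma (in ring) card_independent_lists:
  assumes K: "subfield K R" and E: "dimension m K E" and fin: "finite E"
  shows "of_nat (card {Us. set Us \<subseteq> E \<and> length Us = k \<and> independent K Us}) =
         (\<Prod>l<k. of_nat (card K) ^ m - of_nat (card K) ^ l :: rat)"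
proof (induction k)
  case 0
  have "{Us. set Us \<subseteq> E \<and> length Us = 0 \<and> independent K Us} = {[]}" by auto
  then show ?case by simp
next
  case (Suc k)
  define I where "I k = {Us. set Us \<subseteq> E \<and> length Us = k \<and> independent K Us}" for k
  have finI: "finite (I k)" for k
    using finite_lists_length_eq[OF fin, of k] by (rule finite_subset[rotated]) (auto simp: I_def)
  have Ec: "E \<subseteq> carrier R" using space_subgroup_props(1)[OF K E] .
  have sub: "subalgebra K E R"
    using finite_dimension_imp_subalgebra[OF K finite_dimensionI[OF E]] .
  \<comment> \<open>Independent lists grow at the head, so the range of the new head
    \<open>u\<close> depends on the tail \<open>Us\<close>; hence a dependent sum.\<close>
  have eq: "I (Suc k) = (\<lambda>(Us, u). u # Us) ` (SIGMA Us:I k. E - Span K Us)"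
  proof (rule Set.set_eqI, rule iffI)
    fix W assume "W \<in> I (Suc k)"
    then obtain u Us where W: "W = u # Us" "set Us \<subseteq> E" "u \<in> E" "length Us = k" "independent K (u # Us)"
      by (cases W) (auto simp: I_def)
    then have "Us \<in> I k" "u \<in> E - Span K Us"
      using independent_backwards[OF W(5)] by (auto simp: I_def)
    then show "W \<in> (\<lambda>(Us, u). u # Us) ` (SIGMA Us:I k. E - Span K Us)"
      using W(1) by (auto simp: image_iff)
  next
    fix W assume "W \<in> (\<lambda>(Us, u). u # Us) ` (SIGMA Us:I k. E - Span K Us)"
    then obtain u Us where "W = u # Us" "Us \<in> I k" "u \<in> E - Span K Us" by auto
    then show "W \<in> I (Suc k)" using Ec by (auto simp: I_def intro!: li_Cons)
  qed
  have "inj_on (\<lambda>(Us, u). u # Us) (SIGMA Us:I k. E - Span K Us)"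
    by (auto simp: inj_on_def)
  then have "card (I (Suc k)) = card (SIGMA Us:I k. E - Span K Us)"
    unfolding eq by (rule card_image)
  also have "\<dots> = (\<Sum>Us\<in>I k. card (E - Span K Us))"
    using finI fin by (simp add: card_SigmaI)
  finally have "of_nat (card (I (Suc k))) = (\<Sum>Us\<in>I k. of_nat (card (E - Span K Us)) :: rat)"
    by simp
  also have "\<dots> = (\<Sum>Us\<in>I k. of_nat (card K) ^ m - of_nat (card K) ^ k)"
  proof (rule sum.cong[OF refl])
    fix Us assume Us: "Us \<in> I k"
    then have s: "Span K Us \<subseteq> E" using subalgebra_Span_incl[OF K sub] by (auto simp: I_def)
    have "card (Span K Us) = card K ^ k"
      using card_dimension[OF K dimension_independent[of K Us]] Us by (simp add: I_def del: Span.simps)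
    moreover have "card (E - Span K Us) = card E - card (Span K Us)"
      using s fin by (meson card_Diff_subset finite_subset)
    moreover have "card (Span K Us) \<le> card E" using s fin card_mono by blast
    ultimately show "of_nat (card (E - Span K Us)) = (of_nat (card K) ^ m - of_nat (card K) ^ k :: rat)"
      using card_dimension[OF K E] by (simp add: of_nat_diff del: Span.simps)
  qed
  also have "\<dots> = of_nat (card (I k)) * (of_nat (card K) ^ m - of_nat (card K) ^ k)" by simp
  finally show ?case using Suc.IH by (simp add: I_def)
qed

text \<open>Double counting of the independent lists of length \<open>k\<close> in \<open>E\<close>:
  each spans exactly one \<open>k\<close>-dimensional subspace, and each such subspace has the same
  number of ordered bases, namely the denominator.\<close>

lemma (in ring) card_subspaces_dimension:
  assumes K: "subfield K R" and E: "dimension m K E" and fin: "finite E"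
    and K2: "card K > 1"
  shows "of_nat (card {V. V \<subseteq> E \<and> dimension k K V}) =
    (\<Prod>l<k. of_nat (card K) ^ m - of_nat (card K) ^ l :: rat) /
    (\<Prod>l<k. of_nat (card K) ^ k - of_nat (card K) ^ l)"
proof -
  define I where "I V = {Us. set Us \<subseteq> V \<and> length Us = k \<and> independent K Us}" for V
  define G where "G = {V. V \<subseteq> E \<and> dimension k K V}"
  have finG: "finite G" using fin by (auto simp: G_def)
  have sub: "subalgebra K E R"
    using finite_dimension_imp_subalgebra[OF K finite_dimensionI[OF E]] .
  have Ec: "E \<subseteq> carrier R" using space_subgroup_props(1)[OF K E] .
  have finI: "finite (I V)" if "V \<subseteq> E" for V
    using finite_lists_length_eq[OF finite_subset[OF that fin], of k]
    by (rule finite_subset[rotated]) (auto simp: I_def)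
  \<comment> \<open>An independent list as long as the dimension is a basis, so it determines
    \<open>V\<close>; this makes the sets \<open>I V\<close> disjoint.\<close>
  have span: "Span K Us = V" if "V \<in> G" "Us \<in> I V" for V Us
    using that independent_length_eq_dimension[OF K, of k V Us] by (auto simp: G_def I_def simp del: Span.simps)
  have "I E = (\<Union>V\<in>G. I V)"
  proof (rule Set.set_eqI, rule iffI)
    fix Us assume Us: "Us \<in> I E"
    then have "Span K Us \<in> G"
      using subalgebra_Span_incl[OF K sub, of Us] dimension_independent[of K Us]
      by (auto simp: I_def G_def simp del: Span.simps)
    moreover have "Us \<in> I (Span K Us)"
      using Us Span_base_incl[OF K, of Us] Ec by (auto simp: I_def simp del: Span.simps)
    ultimately show "Us \<in> (\<Union>V\<in>G. I V)" by blast
  next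
    fix Us assume "Us \<in> (\<Union>V\<in>G. I V)"
    then show "Us \<in> I E" by (auto simp: I_def G_def)
  qed
  moreover have "card (\<Union>V\<in>G. I V) = (\<Sum>V\<in>G. card (I V))"
  proof (rule card_UN_disjoint[OF finG])
    show "\<forall>V\<in>G. finite (I V)" using finI by (simp add: G_def)
    show "\<forall>V\<in>G. \<forall>W\<in>G. V \<noteq> W \<longrightarrow> I V \<inter> I W = {}" using span by blast
  qed
  ultimately have "of_nat (card (I E)) = (\<Sum>V\<in>G. of_nat (card (I V)) :: rat)" by simp
  also have "\<dots> = (\<Sum>V\<in>G. (\<Prod>l<k. of_nat (card K) ^ k - of_nat (card K) ^ l))"
    using card_independent_lists[OF K, of k _ k] finite_subset[OF _ fin]
    by (intro sum.cong) (auto simp: I_def G_def)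
  finally have "(\<Prod>l<k. of_nat (card K) ^ m - of_nat (card K) ^ l :: rat) =
      of_nat (card G) * (\<Prod>l<k. of_nat (card K) ^ k - of_nat (card K) ^ l)"
    using card_independent_lists[OF K E fin, of k] by (simp add: I_def)
  moreover have "(\<Prod>l<k. of_nat (card K) ^ k - of_nat (card K) ^ l :: rat) \<noteq> 0"
    using K2 by simp
  ultimately show ?thesis by (simp add: G_def)
qed

lemma (in ring) finite_dimension_carrier:
  assumes "subfield K R" "finite (carrier R)"
  shows "finite_dimension K (carrier R)"
proof -
  obtain Us where Us: "set Us = carrier R" using finite_list[OF assms(2)] by blast
  then have "Span K Us = carrier R"
    using Span_base_incl[OF assms(1), of Us] Span_subgroup_props(1)[OF assms(1), of Us]
    by (simp del: Span.simps)
  then show ?thesis using Span_finite_dimension[OF assms(1), of Us] Us by simp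
qed

lemma (in ring) subfield_card_gt_1:
  assumes "subfield K R" "finite K"
  shows "card K > 1"
proof -
  have "card {\<zero>, \<one>} \<le> card K"
    using assms subringE(2,3)[OF subfieldE(1)[OF assms(1)]] by (intro card_mono) auto
  then show ?thesis using subfieldE(6)[OF assms(1)] by simp
qed

text \<open>The cardinality hypothesis forces the dimension of the whole ring over \<open>K\<close>
  to be \<open>m\<close>. The nonzero subspaces are then sorted by dimension, which runs from 1 to
  \<open>m\<close>.\<close>

lemma (in ring) card_subalgebras:
  assumes K: "subfield K R" and fin: "finite (carrier R)"
    and card: "card (carrier R) = card K ^ m"
  shows "of_nat (card {V. subalgebra K V R \<and> V \<noteq> {\<zero>}}) = num_subspaces m (card K)"
proof -
  have finK: "finite K" using finite_subset[OF subfieldE(3)[OF K] fin] .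
  have K2: "card K > 1" using subfield_card_gt_1[OF K finK] .
  obtain m' where "dimension m' K (carrier R)"
    using finite_dimension_carrier[OF K fin] by blast
  moreover from this have "m' = m"
    using card_dimension[OF K, of m' "carrier R"] card K2 by (simp add: power_inject_exp)
  ultimately have E: "dimension m K (carrier R)" by simp
  define G where "G k = {V. V \<subseteq> carrier R \<and> dimension k K V}" for k
  have "{V. subalgebra K V R \<and> V \<noteq> {\<zero>}} = (\<Union>k\<in>{1..m}. G k)"
  proof (rule Set.set_eqI, rule iffI)
    fix V assume "V \<in> {V. subalgebra K V R \<and> V \<noteq> {\<zero>}}"
    then have V: "subalgebra K V R" "V \<noteq> {\<zero>}" by auto
    have Vc: "V \<subseteq> carrier R" using subalgebra_in_carrier[OF V(1)] .
    obtain k where k: "dimension k K V"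
      using subalbegra_incl_imp_finite_dimension[OF K finite_dimension_carrier[OF K fin] V(1) Vc] by blast
    have "k \<noteq> 0"
    proof
      assume "k = 0"
      then show False using dimension_zero[OF K, of V] k V(2) by simp
    qed
    moreover have "card K ^ k \<le> card K ^ m"
      using card_mono[OF fin Vc] card_dimension[OF K k] card by simp
    then have "k \<le> m" using K2 by simp
    ultimately show "V \<in> (\<Union>k\<in>{1..m}. G k)" using k Vc by (auto simp: G_def)
  next
    fix V assume "V \<in> (\<Union>k\<in>{1..m}. G k)"
    then obtain k where k: "k \<ge> 1" "dimension k K V" by (auto simp: G_def)
    have "V \<noteq> {\<zero>}"
      using dimension_is_inj[OF K k(2), of 0] k(1) by auto
    then show "V \<in> {V. subalgebra K V R \<and> V \<noteq> {\<zero>}}"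
      using finite_dimension_imp_subalgebra[OF K finite_dimensionI[OF k(2)]] by simp
  qed
  moreover have "card (\<Union>k\<in>{1..m}. G k) = (\<Sum>k\<in>{1..m}. card (G k))"
  proof (rule card_UN_disjoint)
    show "\<forall>k\<in>{1..m}. finite (G k)" using fin by (simp add: G_def)
    show "\<forall>k\<in>{1..m}. \<forall>l\<in>{1..m}. k \<noteq> l \<longrightarrow> G k \<inter> G l = {}"
      unfolding G_def using dimension_is_inj[OF K] by blast
  qed simp
  ultimately show ?thesis
    using card_subspaces_dimension[OF K E fin K2] by (simp add: G_def num_subspaces_def)
qed

section \<open>The binomial theorem and additivity of Frobenius powers\<close>

lemma (in cring) binomial_finsum:
  assumes x: "x \<in> carrier R" and y: "y \<in> carrier R"
  shows "(x \<oplus> y) [^] n = (\<Oplus>k\<in>{..n}. [(n choose k)] \<cdot> (x [^] k \<otimes> y [^] (n - k)))"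
proof (induction n)
  case 0
  then show ?case using x y by simp
next
  case (Suc n)
  define f where "f m k = x [^] k \<otimes> y [^] (m - k)" for m k :: nat
  define S where "S m = (\<Oplus>k\<in>{..m}. [(m choose k)] \<cdot> f m k)" for m
  have c: "f m k \<in> carrier R" for m k using x y by (simp add: f_def)
  have xS: "x \<otimes> S n = (\<Oplus>k\<in>{..n}. [(n choose k)] \<cdot> f (Suc n) (Suc k))"
    unfolding S_def using x y c
    by (subst finsum_rdistr) (auto intro!: finsum_cong' simp: add_pow_rdistr f_def m_ac)
  have "y \<otimes> S n = (\<Oplus>k\<in>{..n}. [(n choose k)] \<cdot> f (Suc n) k)"
    unfolding S_def using x y c
    by (subst finsum_rdistr) (auto intro!: finsum_cong' simp: add_pow_rdistr f_def m_ac Suc_diff_le)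
  \<comment> \<open>The added top summand has coefficient \<open>n choose Suc n = 0\<close>. With
    it, splitting off the bottom summand leaves the index range of \<open>x \<otimes> S n\<close>,
    ready for Pascal's rule.\<close>
  also have "\<dots> = (\<Oplus>k\<in>{..Suc n}. [(n choose k)] \<cdot> f (Suc n) k)"
    using c by (subst finsum_Suc) (auto simp: binomial_eq_0)
  also have "\<dots> = (\<Oplus>k\<in>{..n}. [(n choose Suc k)] \<cdot> f (Suc n) (Suc k)) \<oplus> f (Suc n) 0"
    using c by (subst finsum_Suc2) auto
  finally have yS: "y \<otimes> S n = \<dots>" .
  have "S (Suc n) = (\<Oplus>k\<in>{..n}. [(Suc n choose Suc k)] \<cdot> f (Suc n) (Suc k)) \<oplus> f (Suc n) 0"
    unfolding S_def using c by (subst finsum_Suc2) auto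
  also have "(\<Oplus>k\<in>{..n}. [(Suc n choose Suc k)] \<cdot> f (Suc n) (Suc k)) =
    (\<Oplus>k\<in>{..n}. [(n choose k)] \<cdot> f (Suc n) (Suc k) \<oplus> [(n choose Suc k)] \<cdot> f (Suc n) (Suc k))"
    using c by (intro finsum_cong') (auto simp: add.nat_pow_mult)
  also have "\<dots> = x \<otimes> S n \<oplus> (\<Oplus>k\<in>{..n}. [(n choose Suc k)] \<cdot> f (Suc n) (Suc k))"
    unfolding xS using c by (intro finsum_addf) auto
  finally have "S (Suc n) = x \<otimes> S n \<oplus> y \<otimes> S n"
    unfolding yS using x c by (simp add: a_assoc S_def)
  moreover have "S n \<in> carrier R" unfolding S_def using c by simp
  ultimately show ?case
    using Suc.IH x y by (simp add: S_def f_def l_distr r_distr m_comm)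
qed

text \<open>The inner binomial coefficients are divisible by \<open>p\<close>, hence annihilate the
  ring; only the two end terms of the expansion survive.\<close>

lemma (in cring) freshmans_dream:
  fixes p :: nat
  assumes p: "prime p" and char: "[p] \<cdot> \<one> = \<zero>"
    and x: "x \<in> carrier R" and y: "y \<in> carrier R"
  shows "(x \<oplus> y) [^] p = x [^] p \<oplus> y [^] p"
proof -
  \<comment> \<open>With \<open>p\<close> at least 2 the top and bottom summands are distinct and
    can both be split off.\<close>
  obtain m where m: "p = Suc (Suc m)"
    using prime_ge_2_nat[OF p] by (metis add_2_eq_Suc le_Suc_ex)
  have mid: "[(p choose k)] \<cdot> z = \<zero>" if "0 < k" "k < p" "z \<in> carrier R" for k z
  proof -
    have "p dvd p choose k" using that p by (intro dvd_choose_prime) auto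
    then obtain c where c: "p choose k = p * c" by blast
    have "[p] \<cdot> z = \<zero>"
      using add_pow_ldistr[of \<one> z p] char that(3) by simp
    then show ?thesis
      using that(3) add.nat_pow_pow[of z c p] by (simp add: c)
  qed
  define g where "g k = [(p choose k)] \<cdot> (x [^] k \<otimes> y [^] (p - k))" for k
  have g: "g k \<in> carrier R" for k using x y by (simp add: g_def)
  have "(x \<oplus> y) [^] p = (\<Oplus>k\<in>{..Suc (Suc m)}. g k)"
    using binomial_finsum[OF x y, of p] by (simp add: g_def m)
  also have "\<dots> = g p \<oplus> ((\<Oplus>k\<in>{..m}. g (Suc k)) \<oplus> g 0)"
    using g by (subst finsum_Suc, simp, subst finsum_Suc2) (auto simp: m)
  also have "(\<Oplus>k\<in>{..m}. g (Suc k)) = (\<Oplus>k\<in>{..m}. \<zero>)"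
    unfolding g_def using x y by (intro finsum_cong' mid) (auto simp: m)
  finally show ?thesis using x y by (simp add: g_def)
qed

lemma (in cring) freshmans_dream_power:
  fixes p :: nat
  assumes "prime p" and "[p] \<cdot> \<one> = \<zero>" and "x \<in> carrier R" and "y \<in> carrier R"
  shows "(x \<oplus> y) [^] (p ^ k) = x [^] (p ^ k) \<oplus> y [^] (p ^ k)"
proof (induction k)
  case (Suc k)
  have "(x \<oplus> y) [^] (p ^ Suc k) = ((x \<oplus> y) [^] (p ^ k)) [^] p"
    using assms by (simp add: nat_pow_pow mult.commute)
  also have "\<dots> = (x [^] (p ^ k)) [^] p \<oplus> (y [^] (p ^ k)) [^] p"
    unfolding Suc.IH using assms by (intro freshmans_dream) auto
  finally show ?case using assms by (simp add: nat_pow_pow mult.commute)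
qed (use assms in simp)

text \<open>Lagrange's theorem in the additive group kills the \<open>p ^ N\<close>-fold multiple of
  \<open>\<one>\<close>. That multiple is the \<open>N\<close>-th power of the \<open>p\<close>-fold
  one, and a domain has no nonzero nilpotents.\<close>

lemma (in domain) char_eq_zero:
  fixes p :: nat
  assumes "finite (carrier R)" "card (carrier R) = p ^ N"
  shows "[p] \<cdot> \<one> = \<zero>"
proof -
  have o: "[(p ^ N)] \<cdot> \<one> = \<zero>"
    using add.pow_order_eq_1[of \<one>] assms by (simp add: order_def)
  have "[(p ^ k)] \<cdot> \<one> = ([p] \<cdot> \<one>) [^] k" for k
  proof (induction k)
    case (Suc k)
    have "[(p ^ Suc k)] \<cdot> \<one> = [p] \<cdot> ([(p ^ k)] \<cdot> \<one>)"
      by (simp add: add.nat_pow_pow mult.commute)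
    also have "\<dots> = ([(p ^ k)] \<cdot> \<one>) \<otimes> ([p] \<cdot> \<one>)"
      by (simp add: add_pow_rdistr)
    finally show ?case using Suc.IH by simp
  qed simp
  then have z: "([p] \<cdot> \<one>) [^] N = \<zero>" using o by simp
  have "a [^] k = \<zero> \<Longrightarrow> a = \<zero>" if "a \<in> carrier R" for a and k :: nat
    using that by (induction k) (auto simp: integral_iff)
  then show ?thesis using z by simp
qed

section \<open>Subfields of a finite field as fixed points of power maps\<close>

lemma (in field) nonzero_pow_card:
  assumes "finite (carrier R)" "x \<in> carrier R" "x \<noteq> \<zero>"
  shows "x [^] (card (carrier R) - 1) = \<one>"
  using units_power_order_eq_one[of x] assms field_Units finite_ring_finite_units
  by (simp add: card_Diff_singleton)

lemma (in field) pow_card_subfield: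
  assumes A: "subfield A R" and fin: "finite A" and x: "x \<in> A"
  shows "x [^] card A = x"
proof (cases "x = \<zero>")
  case True
  have "card A > 0" using x fin card_gt_0_iff by blast
  then show ?thesis using True by (simp add: nat_pow_zero)
next
  case False
  interpret A: field "R\<lparr>carrier := A\<rparr>" using subfield_iff(2)[OF A] .
  have xc: "x \<in> carrier R" using subfieldE(3)[OF A] x by blast
  have "x [^]\<^bsub>R\<lparr>carrier := A\<rparr>\<^esub> (card A - 1) = \<one>"
    using A.nonzero_pow_card[of x] fin x False by simp
  then have "x [^] (card A - 1) = \<one>" by (simp add: nat_pow_consistent[symmetric])
  moreover have "card A = Suc (card A - 1)" using x fin by (metis Suc_diff_1 card_gt_0_iff empty_iff)
  ultimately show ?thesis using xc by (metis l_one nat_pow_Suc)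
qed

text \<open>A nonzero fixed point is a root of unity of order dividing \<open>m - 1\<close>, and
  there are at most \<open>m - 1\<close> of these; zero adds one more.\<close>

lemma (in field) card_pow_fixed_le:
  assumes fin: "finite (carrier R)" and m: "m > 1"
  shows "card {x \<in> carrier R. x [^] m = x} \<le> m"
proof -
  have "{x \<in> carrier R. x [^] m = x} \<subseteq> insert \<zero> {x \<in> carrier R. x [^] (m - 1) = \<one>}"
  proof
    fix x assume "x \<in> {x \<in> carrier R. x [^] m = x}"
    then have x: "x \<in> carrier R" "x [^] m = x" by auto
    have "x [^] (m - 1) \<otimes> x = \<one> \<otimes> x"
      using x m by (metis Suc_diff_1 l_one nat_pow_Suc order_less_trans zero_less_one)
    then show "x \<in> insert \<zero> {x \<in> carrier R. x [^] (m - 1) = \<one>}"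
      using x(1) m_rcancel[of x "x [^] (m - 1)" \<one>] by (cases "x = \<zero>") auto
  qed
  then have "card {x \<in> carrier R. x [^] m = x} \<le> card (insert \<zero> {x \<in> carrier R. x [^] (m - 1) = \<one>})"
    using fin by (intro card_mono) auto
  also have "\<dots> \<le> Suc (card {x \<in> carrier R. x [^] (m - 1) = \<one>})" using fin by (simp add: card_insert_if)
  also have "\<dots> \<le> Suc (m - 1)" using num_roots_le_deg[OF fin, of "m - 1"] m by simp
  finally show ?thesis using m by simp
qed

text \<open>The inclusion is Fermat's little theorem in \<open>A\<close>, and the right-hand side
  has at most \<open>card A\<close> elements. Consequently a subfield is determined by its
  cardinality.\<close>

lemma (in field) subfield_eq_pow_fixed:
  assumes A: "subfield A R" and fin: "finite (carrier R)"
  shows "A = {x \<in> carrier R. x [^] card A = x}"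
proof (rule card_seteq)
  have finA: "finite A" using finite_subset[OF subfieldE(3)[OF A] fin] .
  show "A \<subseteq> {x \<in> carrier R. x [^] card A = x}"
    using pow_card_subfield[OF A finA] subfieldE(3)[OF A] by auto
  show "card {x \<in> carrier R. x [^] card A = x} \<le> card A"
    using card_pow_fixed_le[OF fin subfield_card_gt_1[OF A finA]] .
qed (use fin in auto)

text \<open>The multiplicative group is cyclic with some generator \<open>a\<close>. If
  \<open>s * r\<close> is its order, then \<open>a [^] s\<close> has order \<open>r\<close> and its
  powers are \<open>r\<close> distinct roots; the degree bound excludes further ones.\<close>

lemma (in field) card_roots_of_unity:
  assumes fin: "finite (carrier R)" and r: "r dvd card (carrier R) - 1"
  shows "card {x \<in> carrier R. x [^] r = \<one>} = r"
proof -
  interpret G: group "mult_of R" rewrites "([^]\<^bsub>mult_of R\<^esub>) = (([^]) :: _ \<Rightarrow> nat \<Rightarrow> _)" and "\<one>\<^bsub>mult_of R\<^esub> = \<one>"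
    by (rule field_mult_group) (simp_all add: nat_pow_mult_of)
  note mult_of_simps[simp]
  have "card {\<zero>, \<one>} \<le> card (carrier R)" using fin by (intro card_mono) auto
  then have pos: "card (carrier R) - 1 > 0" by simp
  obtain a where a: "a \<in> carrier (mult_of R)" and gen: "carrier (mult_of R) = {a [^] i | i::nat. i \<in> UNIV}"
    using finite_field_mult_group_has_gen[OF fin] by blast
  have finm: "finite (carrier (mult_of R))" using fin by simp
  have "G.ord a = card (carrier (mult_of R))"
    using G.generate_pow_card[OF a] G.generate_pow_nat[OF a] G.ord_ge_1[OF finm a] gen
    by (simp del: mult_of_simps)
  then have orda: "G.ord a = card (carrier R) - 1" using fin by simp
  obtain s where s: "card (carrier R) - 1 = s * r" using r by (metis dvd_def mult.commute)
  have s0: "s \<noteq> 0" and r0: "r \<noteq> 0" using pos unfolding s by auto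
  have b: "a [^] s \<in> carrier (mult_of R)" using G.nat_pow_closed[OF a] by simp
  have "G.ord (a [^] s) = r"
    using G.ord_pow[OF a, of s] orda s s0 by simp
  then have inj: "inj_on (\<lambda>i. (a [^] s) [^] i) {1..r}"
    using G.ord_inj'[OF b] by simp
  have ac: "a \<in> carrier R" using a by simp
  have "(a [^] s) [^] r = \<one>"
    using nonzero_pow_card[OF fin, of a] a s by (simp add: nat_pow_pow)
  then have "((a [^] s) [^] i) [^] r = \<one>" for i :: nat
    using ac nat_pow_pow[of "a [^] s" r i] nat_pow_pow[of "a [^] s" i r] by (simp add: mult.commute)
  then have "(\<lambda>i. (a [^] s) [^] i) ` {1..r} \<subseteq> {x \<in> carrier R. x [^] r = \<one>}"
    using ac by auto
  then have "card ((\<lambda>i. (a [^] s) [^] i) ` {1..r}) \<le> card {x \<in> carrier R. x [^] r = \<one>}"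
    using fin by (intro card_mono) auto
  then have "r \<le> card {x \<in> carrier R. x [^] r = \<one>}"
    using inj by (simp add: card_image)
  then show ?thesis using num_roots_le_deg[OF fin r0] by simp
qed

lemma minus_one_dvd_power_minus_one: "x - 1 dvd x ^ m - (1::nat)"
proof (cases "x = 0")
  case False
  have "int x - 1 dvd int x ^ m - 1"
    by (metis dvd_triv_left power_diff_1_eq)
  then have "int (x - 1) dvd int (x ^ m - 1)"
    using False by (simp add: of_nat_diff)
  then show ?thesis by (simp only: int_dvd_int_iff)
qed (cases m; simp)

text \<open>The fixed points of the \<open>c\<close>-fold Frobenius form a subfield. They are zero
  together with the roots of unity of order dividing \<open>p ^ c - 1\<close>, a number that divides
  \<open>p ^ N - 1\<close> because \<open>c\<close> divides \<open>N\<close>.\<close>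

lemma (in field) ex_subfield_card:
  fixes p :: nat
  assumes p: "prime p" and fin: "finite (carrier R)" and card: "card (carrier R) = p ^ N"
    and c: "c dvd N" "c > 0"
  shows "\<exists>A. subfield A R \<and> card A = p ^ c"
proof (intro exI conjI)
  let ?A = "{x \<in> carrier R. x [^] (p ^ c) = x}"
  note char = char_eq_zero[OF fin card]
  have Q1: "p ^ c > 1" using one_less_power[OF prime_gt_1_nat[OF p] c(2)] .
  \<comment> \<open>Both exponents are positive. So zero is a fixed point but not a root of unity,
    which matters in the final count.\<close>
  then have z0: "\<zero> [^] (p ^ c) = \<zero>" "\<zero> [^] (p ^ c - 1) = \<zero>"
    using prime_gt_0_nat[OF p] nat_pow_zero[of "p ^ c"] nat_pow_zero[of "p ^ c - 1"] by simp_all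
  have sub: "subring ?A R"
  proof (rule subringI)
    fix h assume h: "h \<in> ?A"
    \<comment> \<open>Additivity yields the power of \<open>\<ominus> h\<close> without a case
      distinction on the parity of \<open>p\<close>.\<close>
    have "(h \<oplus> \<ominus> h) [^] (p ^ c) = h [^] (p ^ c) \<oplus> (\<ominus> h) [^] (p ^ c)"
      using h by (intro freshmans_dream_power[OF p char]) auto
    moreover have "(h \<oplus> \<ominus> h) [^] (p ^ c) = \<zero>"
      using h z0(1) by (simp add: r_neg)
    ultimately have "h \<oplus> (\<ominus> h) [^] (p ^ c) = \<zero>" using h by simp
    then have "(\<ominus> h) [^] (p ^ c) = \<ominus> h"
      using h minus_equality[of "(\<ominus> h) [^] (p ^ c)" h] by (simp add: a_comm)
    then show "\<ominus> h \<in> ?A" using h by simp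
  next
    fix h1 h2 assume "h1 \<in> ?A" "h2 \<in> ?A"
    then show "h1 \<otimes> h2 \<in> ?A" "h1 \<oplus> h2 \<in> ?A"
      by (auto simp: nat_pow_distrib freshmans_dream_power[OF p char])
  qed auto
  show "subfield ?A R"
  proof (rule subfieldI'[OF sub])
    fix k assume k: "k \<in> ?A - {\<zero>}"
    then have kU: "k \<in> Units R" by (simp add: field_Units)
    have "inv k [^] (p ^ c) \<otimes> k [^] (p ^ c) = (inv k \<otimes> k) [^] (p ^ c)"
      using k kU by (intro nat_pow_distrib[symmetric]) auto
    then have "inv k [^] (p ^ c) \<otimes> k = \<one>" using k kU by simp
    then have "inv k [^] (p ^ c) = inv k"
      using k kU comm_inv_char[of k "inv k [^] (p ^ c)"] by (simp add: m_comm)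
    then show "inv k \<in> ?A" using kU by simp
  qed
  have eq: "?A = insert \<zero> {x \<in> carrier R. x [^] (p ^ c - 1) = \<one>}"
  proof (rule Set.set_eqI)
    fix x
    have "x [^] (p ^ c) = x \<longleftrightarrow> x [^] (p ^ c - 1) = \<one>" if "x \<in> carrier R" "x \<noteq> \<zero>"
    proof -
      have "x [^] (p ^ c) = x [^] (p ^ c - 1) \<otimes> x"
        using Q1 by (metis Suc_diff_1 nat_pow_Suc order_less_trans zero_less_one)
      then show ?thesis using m_rcancel[of x "x [^] (p ^ c - 1)" \<one>] that by simp
    qed
    then show "x \<in> ?A \<longleftrightarrow> x \<in> insert \<zero> {x \<in> carrier R. x [^] (p ^ c - 1) = \<one>}"
      using z0(1) by (cases "x = \<zero>") auto
  qed
  have "p ^ c - 1 dvd card (carrier R) - 1"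
    using c(1) minus_one_dvd_power_minus_one[of "p ^ c"] unfolding card by (auto simp: power_mult)
  then have "card {x \<in> carrier R. x [^] (p ^ c - 1) = \<one>} = p ^ c - 1"
    by (rule card_roots_of_unity[OF fin])
  moreover have "\<zero> \<notin> {x \<in> carrier R. x [^] (p ^ c - 1) = \<one>}"
    using z0(2) by simp
  ultimately show "card ?A = p ^ c" unfolding eq using fin Q1 by simp
qed

section \<open>Stabilizers, their degrees, and the subspaces over a given subfield\<close>

definition (in ring) stabilizer :: "'a set \<Rightarrow> 'a set"
  where "stabilizer V = {x \<in> carrier R. \<forall>v\<in>V. x \<otimes> v \<in> V}"

lemma (in ring) subalgebra_iff_subset_stabilizer:
  assumes "subgroup V (add_monoid R)" "K \<subseteq> carrier R"
  shows "subalgebra K V R \<longleftrightarrow> K \<subseteq> stabilizer V"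
  using assms unfolding subalgebra_def subalgebra_axioms_def stabilizer_def by blast

text \<open>Closure under inverses is the only delicate point: in a finite field the inverse of a
  nonzero element is one of its powers, so closure under products suffices.\<close>

lemma (in field) subfield_stabilizer:
  assumes fin: "finite (carrier R)" and V: "subgroup V (add_monoid R)"
  shows "subfield (stabilizer V) R"
proof (rule subfieldI')
  have Vc: "\<And>v. v \<in> V \<Longrightarrow> v \<in> carrier R" using add.subgroupE(1)[OF V] by blast
  show sub: "subring (stabilizer V) R"
  proof (rule subringI)
    show "stabilizer V \<subseteq> carrier R" "\<one> \<in> stabilizer V"
      using Vc by (auto simp: stabilizer_def)
    show "\<ominus> h \<in> stabilizer V" if "h \<in> stabilizer V" for h
      using that Vc add.subgroupE(3)[OF V] by (auto simp: stabilizer_def l_minus)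
    show "h1 \<otimes> h2 \<in> stabilizer V" "h1 \<oplus> h2 \<in> stabilizer V"
      if "h1 \<in> stabilizer V" "h2 \<in> stabilizer V" for h1 h2
      using that Vc add.subgroupE(4)[OF V] by (auto simp: stabilizer_def m_assoc l_distr)
  qed
  note closed = subringE(3,6)[OF sub]
  show "inv k \<in> stabilizer V" if k: "k \<in> stabilizer V - {\<zero>}" for k
  proof -
    have kc: "k \<in> carrier R" "k \<noteq> \<zero>" using k by (auto simp: stabilizer_def)
    have "k [^] i \<in> stabilizer V" for i :: nat
      using k closed by (induction i) auto
    moreover have "inv k = k [^] (card (carrier R) - 2)"
    proof (rule comm_inv_char)
      \<comment> \<open>Two elements are guaranteed, so the subtraction of 2 in the exponent does
        not truncate.\<close>
      have "card {\<zero>, \<one>} \<le> card (carrier R)" using fin by (intro card_mono) auto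
      then have "card (carrier R) - 1 = Suc (card (carrier R) - 2)" by simp
      then show "k \<otimes> k [^] (card (carrier R) - 2) = \<one>"
        using nonzero_pow_card[OF fin kc] kc by (simp add: m_comm)
    qed (use kc in auto)
    ultimately show ?thesis by simp
  qed
qed

text \<open>\<open>A\<close> is a vector space over \<open>F\<close>, finite-dimensional because the
  ring is finite.\<close>

lemma (in ring) card_subfield_extension:
  assumes F: "subfield F R" and A: "subfield A R" and FA: "F \<subseteq> A" and fin: "finite (carrier R)"
  obtains d where "card A = card F ^ d"
proof -
  note sub = subringE[OF subfieldE(1)[OF A]]
  have "subgroup A (add_monoid R)"
    using sub by (intro add.subgroupI) auto
  then have "subalgebra F A R"
    using FA sub(6) by (intro subalgebra.intro subalgebra_axioms.intro) auto
  then obtain d where "dimension d F A"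
    using subalbegra_incl_imp_finite_dimension[OF F finite_dimension_carrier[OF F fin]] sub(1) by blast
  then show thesis using card_dimension[OF F] that by blast
qed

text \<open>An inclusion makes \<open>B\<close> a vector space over \<open>A\<close>, so the
  exponent of \<open>card B\<close> is a multiple of that of \<open>card A\<close>. Conversely,
  fixed points of the power map for \<open>q ^ d\<close> are fixed by all its iterates, among them
  the map for \<open>q ^ e\<close>.\<close>

lemma (in field) subfield_subset_iff_dvd:
  assumes fin: "finite (carrier R)" and q: "q > 1"
    and A: "subfield A R" "card A = q ^ d" and B: "subfield B R" "card B = q ^ e"
  shows "A \<subseteq> B \<longleftrightarrow> d dvd e"
proof
  assume "A \<subseteq> B"
  then obtain m where "card B = card A ^ m"
    using card_subfield_extension[OF A(1) B(1) _ fin] by blast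
  then have "q ^ e = q ^ (d * m)" using A B by (simp add: power_mult)
  then show "d dvd e" using q by simp
next
  assume "d dvd e"
  then obtain m where m: "e = d * m" by blast
  have "x [^] (q ^ (d * m)) = x" if "x \<in> carrier R" "x [^] (q ^ d) = x" for x
  proof (induction m)
    case (Suc m)
    have "x [^] (q ^ (d * Suc m)) = (x [^] (q ^ d)) [^] (q ^ (d * m))"
      using that(1) by (simp add: nat_pow_pow power_add)
    then show ?case using Suc.IH that(2) by simp
  qed (use that in simp)
  then have "{x \<in> carrier R. x [^] (q ^ d) = x} \<subseteq> {x \<in> carrier R. x [^] (q ^ e) = x}"
    unfolding m by blast
  moreover have "A = {x \<in> carrier R. x [^] (q ^ d) = x}"
    using subfield_eq_pow_fixed[OF A(1) fin] unfolding A(2) .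
  moreover have "B = {x \<in> carrier R. x [^] (q ^ e) = x}"
    using subfield_eq_pow_fixed[OF B(1) fin] unfolding B(2) .
  ultimately show "A \<subseteq> B" by (simp only:)
qed

text \<open>For the subfield \<open>E\<close> with \<open>q ^ e\<close> elements,
  \<open>e dvd d V\<close> means that \<open>E\<close> lies in the stabilizer of \<open>V\<close>,
  that is, that \<open>V\<close> is an \<open>E\<close>-subspace. The field has dimension
  \<open>n div e\<close> over \<open>E\<close>.\<close>

lemma (in field) card_subspaces_stabilizer_degree_dvd:
  assumes fin: "finite (carrier R)" and q: "primepow q" and card: "card (carrier R) = q ^ n"
    and F: "subfield F R" "card F = q" and e: "e dvd n" and n: "n > 0"
    and d: "\<And>V. V \<in> S \<Longrightarrow> card (stabilizer V) = q ^ d V"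
    and S: "S = {V. subalgebra F V R \<and> V \<noteq> {\<zero>}}"
  shows "of_nat (card {V \<in> S. e dvd d V}) = num_subspaces (n div e) (q ^ e)"
proof -
  obtain p k where pk: "prime p" "k > 0" "q = p ^ k" using q unfolding primepow_def by blast
  have q1: "q > 1" using primepow_gt_Suc_0[OF q] by simp
  have e0: "e > 0" using e n by (metis dvd_0_left gr0I less_irrefl)
  \<comment> \<open>The existence lemma wants a prime base, so exponents are scaled by the
    \<open>k\<close> with \<open>q = p ^ k\<close>.\<close>
  obtain E where E: "subfield E R" "card E = q ^ e"
    using ex_subfield_card[OF pk(1) fin, of "k * n" "k * e"] card pk e e0
    by (auto simp: power_mult)
  have FE: "F \<subseteq> E" using subfield_subset_iff_dvd[OF fin q1 F(1) _ E, of 1] F(2) by simp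
  have "subalgebra E V R \<and> V \<noteq> {\<zero>} \<longleftrightarrow> V \<in> S \<and> e dvd d V" for V
  proof -
    have "e dvd d V \<longleftrightarrow> subalgebra E V R" if V: "V \<in> S"
    proof -
      have g: "subgroup V (add_monoid R)" using V subalgebra.axioms(1) unfolding S by blast
      show ?thesis
        using subfield_subset_iff_dvd[OF fin q1 E subfield_stabilizer[OF fin g] d[OF V]]
          subalgebra_iff_subset_stabilizer[OF g subfieldE(3)[OF E(1)]] by simp
    qed
    moreover have "subalgebra F V R" if "subalgebra E V R"
      using that FE unfolding subalgebra_def subalgebra_axioms_def by blast
    ultimately show ?thesis unfolding S by blast
  qed
  then have "{V \<in> S. e dvd d V} = {V. subalgebra E V R \<and> V \<noteq> {\<zero>}}" by blast
  moreover have "card (carrier R) = card E ^ (n div e)"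
    using card E e by (simp add: power_mult[symmetric])
  ultimately show ?thesis using card_subalgebras[OF E(1) fin] E(2) by simp
qed

text \<open>The stabilizer is itself an intermediate field over which \<open>V\<close> is a
  subspace, so it refutes the maximality of any proper subfield of it.\<close>

lemma (in field) maximally_defined_over_iff_stabilizer:
  assumes fin: "finite (carrier R)" and F: "subfield F R" and K: "intermediate_field F K R"
  shows "maximally_defined_over R F K V \<longleftrightarrow>
    subalgebra F V R \<and> V \<noteq> {\<zero>} \<and> stabilizer V = K"
proof (cases "subalgebra F V R")
  case True
  then have g: "subgroup V (add_monoid R)" by (rule subalgebra.axioms(1))
  have iff: "subalgebra K' V R \<longleftrightarrow> K' \<subseteq> stabilizer V" if "intermediate_field F K' R" for K'
    using that by (intro subalgebra_iff_subset_stabilizer[OF g] subfieldE(3))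
      (simp add: intermediate_field_def)
  have "F \<subseteq> stabilizer V"
    using True subalgebra_iff_subset_stabilizer[OF g subfieldE(3)[OF F]] by simp
  then have st: "intermediate_field F (stabilizer V) R"
    using subfield_stabilizer[OF fin g] by (simp add: intermediate_field_def)
  have "subalgebra K V R \<and> (\<forall>K'. intermediate_field F K' R \<and> K \<subset> K' \<longrightarrow> \<not> subalgebra K' V R)
    \<longleftrightarrow> stabilizer V = K"
  proof
    assume *: "subalgebra K V R \<and> (\<forall>K'. intermediate_field F K' R \<and> K \<subset> K' \<longrightarrow> \<not> subalgebra K' V R)"
    then have "K \<subseteq> stabilizer V" using iff[OF K] by simp
    moreover have "\<not> K \<subset> stabilizer V" using * st iff[OF st] by blast
    ultimately show "stabilizer V = K" by blast
  next
    assume *: "stabilizer V = K"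
    show "subalgebra K V R \<and> (\<forall>K'. intermediate_field F K' R \<and> K \<subset> K' \<longrightarrow> \<not> subalgebra K' V R)"
    proof (intro conjI allI impI)
      show "subalgebra K V R" using iff[OF K] * by simp
    next
      fix K' assume "intermediate_field F K' R \<and> K \<subset> K'"
      then show "\<not> subalgebra K' V R" using iff[of K'] * by blast
    qed
  qed
  then show ?thesis using True K by (simp add: maximally_defined_over_def)
qed (simp add: maximally_defined_over_def)

section \<open>Inclusion-exclusion over sets of primes\<close>

text \<open>Every prime factor of \<open>m\<close> is some \<open>u j\<close>, so
  \<open>m = 1\<close> means that no \<open>u j\<close> divides \<open>m\<close>. In the expanded
  product, the conditions for \<open>j \<in> J\<close> merge into one divisibility because distinct
  primes are coprime.\<close>

lemma of_bool_eq_1_inclusion_exclusion: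
  fixes u a :: "'b \<Rightarrow> nat"
  assumes I: "finite I" and u: "\<And>j. j \<in> I \<Longrightarrow> prime (u j)" and inj: "inj_on u I"
    and m: "m dvd (\<Prod>j\<in>I. u j ^ a j)"
  shows "(of_bool (m = 1) :: 'c::comm_ring_1) = (\<Sum>J\<in>Pow I. (-1) ^ card J * of_bool ((\<Prod>j\<in>J. u j) dvd m))"
proof -
  have eq: "m = 1 \<longleftrightarrow> (\<forall>j\<in>I. \<not> u j dvd m)"
  proof
    assume "m = 1"
    then show "\<forall>j\<in>I. \<not> u j dvd m" using u by (metis nat_dvd_1_iff_1 not_prime_1)
  next
    assume A: "\<forall>j\<in>I. \<not> u j dvd m"
    show "m = 1"
    proof (rule ccontr)
      assume "m \<noteq> 1"
      then obtain r where r: "prime r" "r dvd m" using prime_factor_nat by blast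
      then have "r dvd (\<Prod>j\<in>I. u j ^ a j)" using m dvd_trans by blast
      then obtain j where j: "j \<in> I" "r dvd u j ^ a j" using r(1) I by (auto simp: prime_dvd_prod_iff)
      then have "r = u j" using r(1) u by (intro primes_dvd_imp_eq) (auto dest: prime_dvd_power)
      then show False using A r(2) j(1) by simp
    qed
  qed
  have "(of_bool (m = 1) :: 'c) = (\<Prod>j\<in>I. - of_bool (u j dvd m) + 1)"
  proof (cases "m = 1")
    case True
    then show ?thesis using eq by (simp add: prod.neutral)
  next
    case False
    then have "\<exists>j\<in>I. - of_bool (u j dvd m) + 1 = (0 :: 'c)" using eq by auto
    then have "(\<Prod>j\<in>I. - of_bool (u j dvd m) + 1) = (0 :: 'c)" by (rule prod_zero[OF I])
    then show ?thesis using False by simp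
  qed
  also have "\<dots> = (\<Sum>J\<in>Pow I. (\<Prod>j\<in>J. - of_bool (u j dvd m)) * (\<Prod>j\<in>I-J. 1))"
    using I by (rule prod_add)
  also have "\<dots> = (\<Sum>J\<in>Pow I. (-1) ^ card J * of_bool ((\<Prod>j\<in>J. u j) dvd m))"
  proof (rule sum.cong[OF refl])
    fix J assume "J \<in> Pow I"
    then have J: "J \<subseteq> I" "finite J" using I finite_subset by auto
    have "(\<Prod>j\<in>J. u j) dvd m \<longleftrightarrow> (\<forall>j\<in>J. u j dvd m)"
    proof
      assume "\<forall>j\<in>J. u j dvd m"
      with J(2,1) show "(\<Prod>j\<in>J. u j) dvd m"
      proof (induction J rule: finite_induct)
        case (insert j J)
        have "coprime (u j) (\<Prod>l\<in>J. u l)"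
        proof (rule prod_coprime_right)
          fix l assume "l \<in> J"
          then show "coprime (u j) (u l)"
            using insert.hyps insert.prems u inj by (intro primes_coprime) (auto dest: inj_onD)
        qed
        then show ?case using insert by (simp add: divides_mult)
      qed simp
    next
      assume "(\<Prod>j\<in>J. u j) dvd m"
      then show "\<forall>j\<in>J. u j dvd m" using dvd_trans[OF dvd_prodI[OF J(2)]] by blast
    qed
    moreover have "(\<Prod>j\<in>J. of_bool (u j dvd m) :: 'c) = of_bool (\<forall>j\<in>J. u j dvd m)"
      using J(2) by (induction J rule: finite_induct) auto
    ultimately show "(\<Prod>j\<in>J. - of_bool (u j dvd m)) * (\<Prod>j\<in>I-J. 1) =
        ((-1) ^ card J * of_bool ((\<Prod>j\<in>J. u j) dvd m) :: 'c)"
      by (simp add: prod_uminus)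
  qed
  finally show ?thesis .
qed

text \<open>Brings the sum over all subsets into the shape of the theorem: grouped by size, with the
  empty set split off as the leading term.\<close>

lemma sum_Pow_by_card:
  fixes f :: "'b set \<Rightarrow> 'c::comm_ring_1"
  assumes "finite I"
  shows "(\<Sum>J\<in>Pow I. (-1) ^ card J * f J) =
    f {} + (\<Sum>v = 1..card I. (-1) ^ v * (\<Sum>J | J \<subseteq> I \<and> card J = v. f J))"
proof -
  let ?g = "\<lambda>v. \<Sum>J | J \<in> Pow I \<and> card J = v. (-1) ^ card J * f J"
  have "(\<Sum>J\<in>Pow I. (-1) ^ card J * f J) = (\<Sum>v\<in>{0..card I}. ?g v)"
    using assms by (intro sum.group[symmetric]) (auto simp: card_mono)
  also have "\<dots> = ?g 0 + (\<Sum>v = 1..card I. ?g v)"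
    by (simp add: sum.atLeast_Suc_atMost)
  also have "{J. J \<in> Pow I \<and> card J = 0} = {{}}"
    using assms by (auto simp: card_eq_0_iff dest: finite_subset)
  also have "(\<Sum>v = 1..card I. ?g v) = (\<Sum>v = 1..card I. (-1) ^ v * (\<Sum>J | J \<subseteq> I \<and> card J = v. f J))"
    by (simp add: sum_distrib_left)
  finally show ?thesis by simp
qed

section \<open>Assembling the alternating sum\<close>

theorem theorem3p3:
  fixes q n t :: nat
    and u a i :: "nat \<Rightarrow> nat"
    and L :: "('a, 'b) ring_scheme"
    and F K :: "'a set"
  assumes "primepow q"
    and "\<And>j. j \<in> {1..t} \<Longrightarrow> prime (u j)"
    and "inj_on u {1..t}"
    and "n = (\<Prod>j = 1..t. u j ^ a j)"
    and "field L" and "finite (carrier L)" and "card (carrier L) = q ^ n"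
    and "subfield F L" and "card F = q"
    and "\<And>j. j \<in> {1..t} \<Longrightarrow> i j \<le> a j"
    and "intermediate_field F K L" and "card K = q ^ (\<Prod>j = 1..t. u j ^ i j)"
  shows "of_nat (card {V. maximally_defined_over L F K V}) =
    num_subspaces (\<Prod>j = 1..t. u j ^ (a j - i j)) (q ^ (\<Prod>j = 1..t. u j ^ i j))
    + (\<Sum>v = 1..t. (-1) ^ v *
        (\<Sum>J | J \<subseteq> {1..t} \<and> card J = v. num_subspaces_idx q t u a i J))"
proof -
  interpret L: field L by fact
  note fin = \<open>finite (carrier L)\<close> and F = \<open>subfield F L\<close> and pr = assms(2)
  define I where "I = {1..t}"
  define P where "P = (\<Prod>j\<in>I. u j ^ i j)"
  define M where "M = (\<Prod>j\<in>I. u j ^ (a j - i j))"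
  have finI: "finite I" by (simp add: I_def)
  have q1: "q > 1" using primepow_gt_Suc_0[OF assms(1)] by simp
  have upos: "u j > 0" if "j \<in> I" for j using pr[of j] that prime_gt_0_nat by (simp add: I_def)
  have nPM: "n = P * M"
    unfolding P_def M_def assms(4) I_def[symmetric] prod.distrib[symmetric]
    using assms(10) by (intro prod.cong) (auto simp: I_def power_add[symmetric])
  have P0: "P > 0" and M0: "M > 0" using upos by (auto simp: P_def M_def intro!: prod_pos)
  have K: "subfield K L" "card K = q ^ P"
    using assms(11,12) by (auto simp: intermediate_field_def P_def I_def)
  define S where "S = {V. subalgebra F V L \<and> V \<noteq> {\<zero>\<^bsub>L\<^esub>}}"
  have finS: "finite S"
    using fin L.subalgebra_in_carrier by (intro finite_subset[of S "Pow (carrier L)"]) (auto simp: S_def)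
  have st: "subfield (L.stabilizer V) L" "F \<subseteq> L.stabilizer V" if "V \<in> S" for V
  proof -
    have V: "subalgebra F V L" using that by (simp add: S_def)
    note g = subalgebra.axioms(1)[OF V]
    show "subfield (L.stabilizer V) L" by (rule L.subfield_stabilizer[OF fin g])
    show "F \<subseteq> L.stabilizer V"
      using V L.subalgebra_iff_subset_stabilizer[OF g subfieldE(3)[OF F]] by simp
  qed
  \<comment> \<open>The degree of the stabilizer over \<open>F\<close>; it is meaningful for
    \<open>V \<in> S\<close>, where such an exponent exists.\<close>
  define d where "d V = (SOME d. card (L.stabilizer V) = q ^ d)" for V
  have d: "card (L.stabilizer V) = q ^ d V" if V: "V \<in> S" for V
  proof -
    obtain e where "card (L.stabilizer V) = q ^ e"
      using L.card_subfield_extension[OF F st[OF V] fin] assms(9) by metis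
    then show ?thesis unfolding d_def by (rule someI)
  qed
  \<comment> \<open>The whole field counts as a subfield of degree \<open>n\<close> that contains
    the stabilizer.\<close>
  have dn: "d V dvd n" if "V \<in> S" for V
    using L.subfield_subset_iff_dvd[OF fin q1 st(1)[OF that] d[OF that] L.carrier_is_subfield assms(7)]
      subfieldE(3)[OF st(1)[OF that]] by simp
  have count: "of_nat (card {V \<in> S. e dvd d V}) = num_subspaces (n div e) (q ^ e)" if "e dvd n" for e
    using L.card_subspaces_stabilizer_degree_dvd[OF fin assms(1,7) F assms(9) that _ d S_def] P0 M0 nPM
    by simp
  have max: "{V. maximally_defined_over L F K V} = {V \<in> S. d V = P}"
  proof -
    have "L.stabilizer V = K \<longleftrightarrow> d V = P" if "V \<in> S" for V
    proof
      assume "L.stabilizer V = K"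
      then have "q ^ d V = q ^ P" using d[OF that] K(2) by simp
      then show "d V = P" using q1 by simp
    next
      assume "d V = P"
      \<comment> \<open>Equal degrees divide each other, which gives both inclusions.\<close>
      then show "L.stabilizer V = K"
        using L.subfield_subset_iff_dvd[OF fin q1 st(1)[OF that] d[OF that] K]
          L.subfield_subset_iff_dvd[OF fin q1 K st(1)[OF that] d[OF that]] by auto
    qed
    then show ?thesis
      using L.maximally_defined_over_iff_stabilizer[OF fin F assms(11)] by (auto simp: S_def)
  qed
  \<comment> \<open>Raising the exponents \<open>i j\<close> by one for \<open>j \<in> J\<close>
    multiplies the degree \<open>P\<close> by the product of those primes. The default value 0 is
    the correct count when an exponent would exceed \<open>a j\<close>.\<close>
  have idx: "num_subspaces_idx q t u a i J = of_nat (card {V \<in> S. P * (\<Prod>j\<in>J. u j) dvd d V})"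
    if J: "J \<subseteq> I" for J
  proof (cases "\<forall>j\<in>J. i j + 1 \<le> a j")
    case True
    define N where "N = (\<Prod>j\<in>J. u j ^ (a j - i j - 1)) * (\<Prod>\<mu>\<in>I - J. u \<mu> ^ (a \<mu> - i \<mu>))"
    have PJ: "(\<Prod>j\<in>J. u j ^ (i j + 1)) * (\<Prod>\<mu>\<in>I - J. u \<mu> ^ i \<mu>) = P * (\<Prod>j\<in>J. u j)"
      unfolding P_def prod.subset_diff[OF J finI] by (simp add: prod.distrib)
    have "(\<Prod>j\<in>J. u j ^ (a j - i j)) = (\<Prod>j\<in>J. u j ^ (a j - i j - 1) * u j)"
    proof (rule prod.cong[OF refl])
      fix j assume "j \<in> J"
      then have "a j - i j = Suc (a j - i j - 1)" using True by force
      then show "u j ^ (a j - i j) = u j ^ (a j - i j - 1) * u j" by (metis power_Suc2)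
    qed
    then have "M = N * (\<Prod>j\<in>J. u j)"
      unfolding M_def N_def prod.subset_diff[OF J finI] by (simp add: prod.distrib)
    then have n: "n = P * (\<Prod>j\<in>J. u j) * N" using nPM by simp
    moreover have "P * (\<Prod>j\<in>J. u j) > 0" using n nPM P0 M0 by (metis gr0I mult_is_0 nat_less_le)
    ultimately have "n div (P * (\<Prod>j\<in>J. u j)) = N" by simp
    then show ?thesis
      using count[of "P * (\<Prod>j\<in>J. u j)"] n True PJ
      by (simp add: num_subspaces_idx_def N_def I_def)
  next
    case False
    then obtain j where j: "j \<in> J" "a j - i j = 0" by force
    have jI: "j \<in> I" using j J by blast
    \<comment> \<open>Since \<open>d V\<close> divides \<open>P * M\<close>, the prime
      \<open>u j\<close> would divide \<open>M\<close>, where its exponent \<open>a j - i j\<close>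
      is 0 and the other factors are powers of other primes.\<close>
    have "\<not> P * (\<Prod>j\<in>J. u j) dvd d V" if "V \<in> S" for V
    proof
      assume "P * (\<Prod>j\<in>J. u j) dvd d V"
      then have "P * (\<Prod>j\<in>J. u j) dvd P * M" using dn[OF that] nPM dvd_trans by blast
      then have "(\<Prod>j\<in>J. u j) dvd M" using P0 by simp
      moreover have "u j dvd (\<Prod>j\<in>J. u j)" using j(1) finite_subset[OF J finI] by (simp add: dvd_prodI)
      ultimately have "u j dvd M" using dvd_trans by blast
      then obtain k where k: "k \<in> I" "u j dvd u k ^ (a k - i k)"
        using finI pr[of j] jI by (auto simp: M_def prime_dvd_prod_iff I_def)
      then have "u j dvd u k" using pr[of j] jI prime_dvd_power by (auto simp: I_def)
      then have "u j = u k" using pr[of j] pr[of k] jI k(1) by (intro primes_dvd_imp_eq) (auto simp: I_def)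
      then have "j = k" using assms(3) jI k(1) by (auto simp: I_def dest: inj_onD)
      then show False using k(2) j(2) pr[of j] jI by (auto simp: I_def)
    qed
    then have "{V \<in> S. P * (\<Prod>j\<in>J. u j) dvd d V} = {}" by blast
    then have "card {V \<in> S. P * (\<Prod>j\<in>J. u j) dvd d V} = 0" by (simp only: card.empty)
    then show ?thesis unfolding num_subspaces_idx_def by (simp only: False if_False of_nat_0)
  qed
  \<comment> \<open>If \<open>P\<close> divides \<open>d V\<close>, the expansion applies to the
    cofactor \<open>m\<close>; otherwise both sides vanish.\<close>
  have sign: "(of_bool (d V = P) :: rat) =
      (\<Sum>J\<in>Pow I. (-1) ^ card J * of_bool (P * (\<Prod>j\<in>J. u j) dvd d V))" if V: "V \<in> S" for V
  proof (cases "P dvd d V")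
    case True
    then obtain m where m: "d V = P * m" by blast
    have "m dvd M" using dn[OF V] P0 unfolding m nPM by simp
    then have "(of_bool (m = 1) :: rat) = (\<Sum>J\<in>Pow I. (-1) ^ card J * of_bool ((\<Prod>j\<in>J. u j) dvd m))"
      using of_bool_eq_1_inclusion_exclusion[OF finI, of u m "\<lambda>j. a j - i j"] pr assms(3)
      by (simp add: I_def M_def)
    then show ?thesis using P0 unfolding m by simp
  next
    case False
    then have "d V \<noteq> P" "\<not> P * k dvd d V" for k by (auto dest: dvd_mult_left)
    then show ?thesis by simp
  qed
  have card_bool: "of_nat (card {V \<in> S. Q V}) = (\<Sum>V\<in>S. of_bool (Q V) :: rat)" for Q
    using finS by (simp add: sum_of_bool_eq Int_def)
  have "of_nat (card {V. maximally_defined_over L F K V}) = (\<Sum>V\<in>S. of_bool (d V = P) :: rat)"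
    unfolding max by (rule card_bool)
  also have "\<dots> = (\<Sum>V\<in>S. \<Sum>J\<in>Pow I. (-1) ^ card J * of_bool (P * (\<Prod>j\<in>J. u j) dvd d V))"
    using sign by (intro sum.cong) auto
  also have "\<dots> = (\<Sum>J\<in>Pow I. (-1) ^ card J * num_subspaces_idx q t u a i J)"
    \<comment> \<open>After exchanging the sums, the inner sum over \<open>V\<close> is the count in
      \<open>idx\<close>.\<close>
    by (subst sum.swap) (auto intro!: sum.cong simp: idx card_bool sum_distrib_left)
  also have "\<dots> = num_subspaces_idx q t u a i {} +
      (\<Sum>v = 1..t. (-1) ^ v * (\<Sum>J | J \<subseteq> I \<and> card J = v. num_subspaces_idx q t u a i J))"
    using sum_Pow_by_card[OF finI, of "num_subspaces_idx q t u a i"] by (simp add: I_def)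
  \<comment> \<open>For \<open>J = {}\<close> the products over \<open>J\<close> are 1, which leaves
    the leading term of the formula.\<close>
  finally show ?thesis by (simp add: num_subspaces_idx_def I_def)
qed

end
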